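(* Let $k<m$ be positive integers, $n=m-k$, let $D\in\mathbb{R}^{k\times m}$ have rank $k$, and fix $v\in\mathbb{R}^k$, $v\ne 0$, and $w\in\mathbb{R}^m$ with $Dw=v$. Let $F:(0,\infty)^m\to\mathbb{R}$ be a function and let $\rho$ be a bounded probability density on $\mathbb{R}^m$ supported in a box $\prod_{i=1}^m[q_i^\ell,q_i^u]$ with $0<q_i^\ell<q_i^u$. For each matrix $W\in\mathbb{R}^{m\times n}$ whose columns form an orthonormal basis of the null space of $D$, assume that the dimensionless dependent variable satisfies $$F(\mathbf{q})\exp\left(-w^T\log(\mathbf{q})\right)=g_W\left(W^T\log(\mathbf{q})\right)\qquad\text{for all }\mathbf{q}\in(0,\infty)^m$$ for a function $g_W:\mathbb{R}^n\to\mathbb{R}$ that is differentiable with continuous partial derivatives that are square integrable with respect to $\sigma_W$, where $\sigma_W$ is the probability density of the random vector $\gamma=W^T\log(\mathbf{q})$ when $\mathbf{q}$ has density $\rho$. Let $$C_W=\int \nabla g_W(\gamma)\,\nabla g_W(\gamma)^T\,\sigma_W(\gamma)\,d\gamma\in\mathbb{R}^{n\times n}.$$ Assume that, for one such matrix $W$, the eigenvalues of $C_W$ are distinct, $\lambda_1>\cdots>\lambda_n$. Then the vectors $z_i=Wu_i$, where $u_i$ is an eigenvector of $C_W$ for its $i$-th largest eigenvalue, are unique up to a constant and do not depend on the choice of $W$: if $W'\in\mathbb{R}^{m\times n}$ is any matrix whose columns form an orthonormal basis of the null space of $D$, and for each $i=1,\dots,n$, $u_i$ is an eigenvector of $C_W$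 for its $i$-th largest eigenvalue and $u_i'$ is an eigenvector of $C_{W'}$ for its $i$-th largest eigenvalue (eigenvalues counted with multiplicity), then for every $i=1,\dots,n$ there is a nonzero constant $c_i\in\mathbb{R}$ with $W'u_i'=c_i\,Wu_i$.
   Context: The logarithm of a vector with positive entries is taken componentwise. Interpretation: the columns of $D$ are the dimension vectors (exponents of $k$ base dimensions) of $m$ independent physical quantities $\mathbf{q}=(q_1,\dots,q_m)^T$; $v$ is the dimension vector of the dependent quantity $q=F(\mathbf{q})$; $\exp(-w^T\log(\mathbf{q}))$ nondimensionalizes $q$. The vectors $z_i=Wu_i$ are the exponents of the dimensionless groups $\hat\pi_i=\exp(z_i^T\log(\mathbf{q}))$. *)

theory Defs
  imports "HOL-Probability.Probability" "HOL-Computational_Algebra.Polynomial"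
begin

definition log_vec :: "real^'m \<Rightarrow> real^'m"
  where "log_vec q = (\<chi> i. ln (q $ i))"

definition orthonormal_null_basis :: "real^'m^'k \<Rightarrow> real^'n^'m \<Rightarrow> bool"
  where "orthonormal_null_basis D W \<longleftrightarrow>
    (\<forall>i j. column i W \<bullet> column j W = (if i = j then 1 else 0)) \<and>
    span (columns W) = {x. D *v x = 0}"

definition prob_density :: "('a::euclidean_space \<Rightarrow> real) \<Rightarrow> bool"
  where "prob_density \<rho> \<longleftrightarrow>
    \<rho> \<in> borel_measurable borel \<and> (\<forall>x. 0 \<le> \<rho> x) \<and> prob_space (density lborel \<rho>)"

text \<open>The vector of partial derivatives, meaningful where \<open>f\<close> is differentiable.\<close>

definition grad :: "(real^'n \<Rightarrow> real) \<Rightarrow> real^'n \<Rightarrow> real^'n"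
  where "grad f x = (\<chi> i. frechet_derivative f (at x) (axis i 1))"

definition grad_outer_matrix :: "(real^'n \<Rightarrow> real) \<Rightarrow> (real^'n \<Rightarrow> real) \<Rightarrow> real^'n^'n"
  where "grad_outer_matrix g \<sigma> =
    (\<chi> i j. LINT \<gamma>|lborel. grad g \<gamma> $ i * grad g \<gamma> $ j * \<sigma> \<gamma>)"

definition charpoly :: "real^'n^'n \<Rightarrow> real poly"
  where "charpoly A = det (\<chi> i j. (if i = j then [:0, 1:] else 0) - [:A $ i $ j:])"

text \<open>
  The real roots of the characteristic polynomial with their multiplicities, in decreasing
  order. For a symmetric matrix, such as a \<open>grad_outer_matrix\<close>, all roots are real, so that
  the list has length \<open>CARD('n)\<close>. The index of \<open>nth_largest_eigenvalue\<close> starts at 1.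
\<close>

definition eigenvalues_desc :: "real^'n^'n \<Rightarrow> real list"
  where "eigenvalues_desc A = rev (sorted_list_of_multiset (proots (charpoly A)))"

definition nth_largest_eigenvalue :: "real^'n^'n \<Rightarrow> nat \<Rightarrow> real"
  where "nth_largest_eigenvalue A i = eigenvalues_desc A ! (i - 1)"

definition is_eigenvector :: "real^'n^'n \<Rightarrow> real \<Rightarrow> real^'n \<Rightarrow> bool"
  where "is_eigenvector A \<mu> u \<longleftrightarrow> u \<noteq> 0 \<and> A *v u = \<mu> *\<^sub>R u"

end

theory Submission imports Defs begin

text \<open>
  The matrices \<open>W\<close> and \<open>W'\<close> are two orthonormal bases of one subspace, so \<open>W' = W Q\<close> for the
  orthogonal transition matrix \<open>Q = W\<^sup>T W'\<close>, and the coordinates \<open>W\<^sup>T x\<close> and \<open>W'\<^sup>T x\<close> of any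
  vector \<open>x\<close>, inside the subspace or not, are related by \<open>W\<^sup>T x = Q (W'\<^sup>T x)\<close>. Every point \<open>\<gamma>\<close> is
  \<open>W'\<^sup>T log q\<close> for the positive vector \<open>q = exp (W' \<gamma>)\<close>. The two representations of the
  same dimensionless variable therefore give \<open>g\<^bsub>W'\<^esub>(\<gamma>) = g\<^bsub>W\<^esub>(Q \<gamma>)\<close> everywhere, and by the
  chain rule \<open>\<nabla>g\<^bsub>W'\<^esub>(\<gamma>) = Q\<^sup>T \<nabla>g\<^bsub>W\<^esub>(Q \<gamma>)\<close>.

  Read as an expectation over \<open>q\<close>, the entries of \<open>C\<^bsub>W\<^esub>\<close> do not refer to the density
  \<open>\<sigma>\<^bsub>W\<^esub>\<close>, and the chain rule turns into \<open>C\<^bsub>W'\<^esub> = Q\<^sup>T C\<^bsub>W\<^esub> Q\<close>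
  (\<open>grad_outer_matrix_change_of_variables\<close>). The matrices are similar, hence have the same
  characteristic polynomial and the same ordered list of eigenvalues (\<open>charpoly_similar\<close>),
  and \<open>Q u'\<^sub>i\<close> is an eigenvector of \<open>C\<^bsub>W\<^esub>\<close> for its \<open>i\<close>-th eigenvalue. As the spectrum of
  \<open>C\<^bsub>W\<^esub>\<close> is simple, \<open>Q u'\<^sub>i = c u\<^sub>i\<close> with \<open>c \<noteq> 0\<close>
  (\<open>simple_spectrum_eigenvector_unique\<close>), so that \<open>W' u'\<^sub>i = W Q u'\<^sub>i = c W u\<^sub>i\<close>.
\<close>

section \<open>Simple spectra and similarity\<close>

\<comment> \<open>Matrices act from the left throughout; row-vector products would split the algebra into two forms.\<close>
declare transpose_matrix_vector [simp del]

lemma eigenvectors_orthogonal: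
  fixes A :: "real^'n^'n"
  assumes "transpose A = A" "A *v x = a *\<^sub>R x" "A *v y = b *\<^sub>R y" "a \<noteq> b"
  shows "x \<bullet> y = 0"
proof -
  have "a * (x \<bullet> y) = (A *v x) \<bullet> y"
    using assms(2) by simp
  also have "\<dots> = x \<bullet> (A *v y)"
    using assms(1) by (metis dot_lmul_matrix transpose_matrix_vector)
  also have "\<dots> = b * (x \<bullet> y)"
    using assms(3) by simp
  finally show ?thesis
    using assms(4) by simp
qed

text \<open>
  Eigenvectors of a symmetric matrix for distinct eigenvalues are orthogonal. The part of \<open>x\<close>
  orthogonal to \<open>u i\<close> is again in the eigenspace of \<open>\<mu> i\<close>, so it is orthogonal to all \<open>u j\<close>,
  which already are \<open>CARD('n)\<close> orthogonal directions; it must vanish.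
\<close>

lemma simple_spectrum_eigenvector_unique:
  fixes A :: "real^'n^'n"
  assumes sym: "transpose A = A"
    and card: "card I = CARD('n)" and inj: "inj_on \<mu> I"
    and eig: "\<And>j. j \<in> I \<Longrightarrow> is_eigenvector A (\<mu> j) (u j)"
    and i: "i \<in> I" and x: "is_eigenvector A (\<mu> i) x"
  shows "\<exists>c. c \<noteq> 0 \<and> x = c *\<^sub>R u i"
proof -
  define c where "c = (x \<bullet> u i) / (u i \<bullet> u i)"
  define y where "y = x - c *\<^sub>R u i"
  have ui: "u i \<noteq> 0" "A *v u i = \<mu> i *\<^sub>R u i"
    using eig[OF i] by (auto simp: is_eigenvector_def)
  have Ay: "A *v y = \<mu> i *\<^sub>R y"
    using x ui by (simp add: y_def is_eigenvector_def matrix_vector_mult_diff_distrib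
        matrix_vector_mult_scaleR algebra_simps)
  have orth_u: "u j \<bullet> u k = 0" if "j \<in> I" "k \<in> I" "j \<noteq> k" for j k
    using eigenvectors_orthogonal[OF sym] eig that inj
    unfolding is_eigenvector_def inj_on_def by metis
  have orth_y: "u j \<bullet> y = 0" if "j \<in> I" for j
  proof (cases "j = i")
    case True
    then show ?thesis
      using ui by (simp add: y_def c_def inner_diff_right inner_commute)
  next
    case False
    then show ?thesis
      using eigenvectors_orthogonal[OF sym _ Ay] eig that i inj
      unfolding is_eigenvector_def inj_on_def by metis
  qed
  have "y = 0"
  proof (rule ccontr)
    assume "y \<noteq> 0"
    have "finite I"
      using card by (metis card.infinite zero_less_card_finite less_irrefl)
    have "inj_on u I"
      using orth_u eig unfolding is_eigenvector_def inj_on_def by (metis inner_eq_zero_iff)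
    moreover have "y \<notin> u ` I"
      using orth_y \<open>y \<noteq> 0\<close> by (metis imageE inner_eq_zero_iff)
    ultimately have "card (insert y (u ` I)) = Suc CARD('n)"
      using \<open>finite I\<close> card by (simp add: card_image)
    moreover have "independent (insert y (u ` I))"
    proof (rule pairwise_orthogonal_independent)
      show "pairwise orthogonal (insert y (u ` I))"
        using orth_u orth_y by (auto simp: pairwise_def orthogonal_def inner_commute)
      show "0 \<notin> insert y (u ` I)"
        using eig \<open>y \<noteq> 0\<close> by (auto simp: is_eigenvector_def)
    qed
    ultimately show False
      using independent_bound[of "insert y (u ` I)"] by simp
  qed
  then have "x = c *\<^sub>R u i"
    by (simp add: y_def)
  moreover have "x \<noteq> 0"
    using x by (simp add: is_eigenvector_def)
  ultimately show ?thesis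
    by auto
qed

text \<open>
  Over the polynomial ring, conjugation by the constant matrix \<open>Q\<close> fixes the scalar matrix
  with entry \<open>[:0, 1:]\<close>, so it carries the characteristic matrix of \<open>A\<close> to that of \<open>B\<close>. The
  factor \<open>det Q\<close> cancels because it is a unit, with inverse \<open>det P\<close>.
\<close>

lemma charpoly_similar:
  fixes A B P Q :: "real^'n^'n"
  assumes PQ: "P ** Q = mat 1" and sim: "A ** Q = Q ** B"
  shows "charpoly A = charpoly B"
proof -
  define X :: "real poly^'n^'n" where "X = (\<chi> i j. if i = j then [:0, 1:] else 0)"
  define C :: "real^'n^'n \<Rightarrow> real poly^'n^'n" where "C M = (\<chi> i j. [:M $ i $ j:])" for M
  have charpoly: "charpoly M = det (X - C M)" for M
    unfolding charpoly_def X_def C_def by (rule arg_cong[where f = det]) (simp add: vec_eq_iff)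
  have C_mult: "C M ** C N = C (M ** N)" for M N
    by (simp add: C_def vec_eq_iff matrix_matrix_mult_def sum_to_poly mult.commute)
  have C_one: "C (mat 1) = mat 1"
    by (simp add: C_def vec_eq_iff mat_def one_pCons)
  have X_comm: "X ** M = M ** X" for M
    by (simp add: X_def vec_eq_iff matrix_matrix_mult_def if_distrib if_distribR sum.delta
        mult.commute cong: if_cong)
  have diff_l: "(M - N) ** L = M ** L - N ** L" for L M N :: "real poly^'n^'n"
    by (simp add: vec_eq_iff matrix_matrix_mult_def left_diff_distrib sum_subtractf)
  have diff_r: "L ** (M - N) = L ** M - L ** N" for L M N :: "real poly^'n^'n"
    by (simp add: vec_eq_iff matrix_matrix_mult_def right_diff_distrib sum_subtractf)
  have "(X - C A) ** C Q = C Q ** (X - C B)"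
    by (simp add: diff_l diff_r X_comm C_mult sim)
  then have "charpoly A * det (C Q) = det (C Q) * charpoly B"
    unfolding charpoly by (metis det_mul)
  moreover have "det (C P) * det (C Q) = 1"
    by (simp add: det_mul[symmetric] C_mult PQ C_one)
  ultimately show ?thesis
    by (metis mult.commute mult_cancel_left mult_zero_right zero_neq_one)
qed

section \<open>Gradients under a linear change of variables\<close>

lemma grad_compose_matrix:
  fixes f :: "real^'n \<Rightarrow> real" and Q :: "real^'p^'n"
  assumes "f differentiable (at (Q *v x))"
  shows "grad (\<lambda>y. f (Q *v y)) x = transpose Q *v grad f (Q *v x)"
proof -
  let ?f' = "frechet_derivative f (at (Q *v x))"
  have lin: "linear ?f'"
    using assms by (rule linear_frechet_derivative)
  have inner: "?f' h = grad f (Q *v x) \<bullet> h" for h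
  proof -
    have "?f' h = ?f' (\<Sum>i\<in>UNIV. h $ i *\<^sub>R axis i 1)"
      using basis_expansion[of h] by (simp add: scalar_mult_eq_scaleR)
    also have "\<dots> = (\<Sum>i\<in>UNIV. h $ i * ?f' (axis i 1))"
      using lin by (simp add: linear_sum linear_scale)
    finally show ?thesis
      by (simp add: grad_def inner_vec_def mult.commute)
  qed
  have "((\<lambda>y. f (Q *v y)) has_derivative (\<lambda>h. ?f' (Q *v h))) (at x)"
    using diff_chain_at[of "(*v) Q" "(*v) Q" x f ?f'] assms
    by (simp add: o_def frechet_derivative_works bounded_linear_imp_has_derivative)
  then have "frechet_derivative (\<lambda>y. f (Q *v y)) (at x) = (\<lambda>h. ?f' (Q *v h))"
    by (rule frechet_derivative_at[symmetric])
  then show ?thesis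
    by (simp add: vec_eq_iff grad_def[of "\<lambda>y. f (Q *v y)"] inner matrix_vector_mult_basis
        inner_commute) (simp add: column_def transpose_def inner_vec_def matrix_vector_mult_def mult.commute)
qed

text \<open>
  Writing the matrix as an expectation over \<open>M\<close> removes the density, which is determined only
  almost everywhere: no pointwise relation between densities of \<open>X\<close> and of a linear image of
  \<open>X\<close> has to be derived.
\<close>

lemma grad_outer_matrix_expectation:
  assumes X: "distributed M lborel X \<sigma>" and nonneg: "\<And>\<gamma>. 0 \<le> \<sigma> \<gamma>"
    and meas: "\<And>i. (\<lambda>\<gamma>. grad f \<gamma> $ i) \<in> borel_measurable borel"
  shows "grad_outer_matrix f \<sigma> $ i $ j = (LINT q|M. grad f (X q) $ i * grad f (X q) $ j)"
  using distributed_integral[OF X, of "\<lambda>\<gamma>. grad f \<gamma> $ i * grad f \<gamma> $ j"] meas nonneg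
  by (simp add: grad_outer_matrix_def mult.commute)

text \<open>
  The mixed products are dominated by sums of squares. Integrability is what permits exchanging the
  finite sums of the chain rule with the integral, since the Bochner integral of a
  non-integrable function is zero by convention and need not be additive.
\<close>

lemma grad_products_integrable:
  assumes X: "distributed M lborel X \<sigma>" and nonneg: "\<And>\<gamma>. 0 \<le> \<sigma> \<gamma>"
    and meas: "\<And>i. (\<lambda>\<gamma>. grad f \<gamma> $ i) \<in> borel_measurable borel"
    and sq: "\<And>i. integrable lborel (\<lambda>\<gamma>. (grad f \<gamma> $ i)\<^sup>2 * \<sigma> \<gamma>)"
  shows "integrable M (\<lambda>q. grad f (X q) $ i * grad f (X q) $ j)"
proof -
  note [measurable] = meas
  have [measurable]: "X \<in> borel_measurable M"
    using distributed_measurable[OF X] by simp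
  have int_sq: "integrable M (\<lambda>q. (grad f (X q) $ i)\<^sup>2)" for i
    using distributed_integrable[OF X, of "\<lambda>\<gamma>. (grad f \<gamma> $ i)\<^sup>2"] nonneg sq[of i]
    by (simp add: mult.commute)
  show ?thesis
  proof (rule Bochner_Integration.integrable_bound)
    show "integrable M (\<lambda>q. (grad f (X q) $ i)\<^sup>2 + (grad f (X q) $ j)\<^sup>2)"
      by (intro Bochner_Integration.integrable_add int_sq)
    have "\<bar>a * b\<bar> \<le> a\<^sup>2 + b\<^sup>2" for a b :: real
      using sum_squares_bound[of "\<bar>a\<bar>" "\<bar>b\<bar>"] mult_nonneg_nonneg[of "\<bar>a\<bar>" "\<bar>b\<bar>"]
      unfolding abs_mult power2_abs by linarith
    then show "AE q in M. norm (grad f (X q) $ i * grad f (X q) $ j)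
        \<le> norm ((grad f (X q) $ i)\<^sup>2 + (grad f (X q) $ j)\<^sup>2)"
      by simp
  qed measurable
qed

lemma grad_outer_matrix_change_of_variables:
  fixes f :: "real^'n \<Rightarrow> real" and Q :: "real^'p^'n"
  assumes X: "distributed M lborel X \<sigma>" and \<sigma>: "\<And>\<gamma>. 0 \<le> \<sigma> \<gamma>"
    and Y: "distributed M lborel Y \<tau>" and \<tau>: "\<And>\<gamma>. 0 \<le> \<tau> \<gamma>"
    and XY: "\<And>q. q \<in> space M \<Longrightarrow> X q = Q *v Y q"
    and diff: "\<And>\<gamma>. f differentiable (at \<gamma>)"
    and meas: "\<And>i. (\<lambda>\<gamma>. grad f \<gamma> $ i) \<in> borel_measurable borel"
    and sq: "\<And>i. integrable lborel (\<lambda>\<gamma>. (grad f \<gamma> $ i)\<^sup>2 * \<sigma> \<gamma>)"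
  shows "grad_outer_matrix (\<lambda>y. f (Q *v y)) \<tau> = transpose Q ** grad_outer_matrix f \<sigma> ** Q"
proof -
  let ?h = "\<lambda>y. f (Q *v y)"
  have grad_h: "grad ?h y $ i = (\<Sum>k\<in>UNIV. Q $ k $ i * grad f (Q *v y) $ k)" for y i
    unfolding grad_compose_matrix[OF diff] by (simp add: matrix_vector_mult_def transpose_def)
  have [measurable]: "(\<lambda>y. Q *v y) \<in> borel_measurable borel"
    by (intro borel_measurable_continuous_onI linear_continuous_on) (simp add: linear_linear)
  have meas_h: "(\<lambda>y. grad ?h y $ i) \<in> borel_measurable borel" for i
    unfolding grad_h using meas by measurable
  have "grad_outer_matrix ?h \<tau> $ i $ j = (transpose Q ** grad_outer_matrix f \<sigma> ** Q) $ i $ j" for i j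
  proof -
    have "grad_outer_matrix ?h \<tau> $ i $ j = (LINT q|M. grad ?h (Y q) $ i * grad ?h (Y q) $ j)"
      by (rule grad_outer_matrix_expectation[OF Y \<tau> meas_h])
    also have "\<dots> = (LINT q|M. (\<Sum>k\<in>UNIV. \<Sum>l\<in>UNIV.
        Q $ k $ i * Q $ l $ j * (grad f (X q) $ k * grad f (X q) $ l)))"
      by (rule Bochner_Integration.integral_cong)
         (simp_all add: grad_h XY sum_product mult_ac)
    also have "\<dots> = (\<Sum>k\<in>UNIV. \<Sum>l\<in>UNIV. Q $ k $ i * Q $ l $ j *
        (LINT q|M. grad f (X q) $ k * grad f (X q) $ l))"
      using grad_products_integrable[OF X \<sigma> meas sq] by simp
    also have "\<dots> = (\<Sum>k\<in>UNIV. \<Sum>l\<in>UNIV. Q $ k $ i * Q $ l $ j * grad_outer_matrix f \<sigma> $ k $ l)"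
      by (simp add: grad_outer_matrix_expectation[OF X \<sigma> meas])
    also have "\<dots> = (transpose Q ** grad_outer_matrix f \<sigma> ** Q) $ i $ j"
      by (subst sum.swap)
         (simp add: matrix_matrix_mult_def transpose_def sum_distrib_left mult_ac)
    finally show ?thesis .
  qed
  then show ?thesis
    by (simp add: vec_eq_iff)
qed

lemma transpose_grad_outer_matrix: "transpose (grad_outer_matrix f \<sigma>) = grad_outer_matrix f \<sigma>"
  by (simp add: grad_outer_matrix_def transpose_def vec_eq_iff mult_ac)

section \<open>Orthonormal bases of the same null space\<close>

lemma orthonormal_null_basis_transpose_mult:
  assumes "orthonormal_null_basis D W"
  shows "transpose W ** W = mat 1"
  using assms
  by (simp add: orthonormal_null_basis_def vec_eq_iff matrix_mult_transpose_dot_column mat_def)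

text \<open>\<open>W W\<^sup>T\<close> is the orthogonal projection onto the null space, hence fixes its elements.\<close>

lemma orthonormal_null_basis_projection:
  fixes W :: "real^'n^'m"
  assumes W: "orthonormal_null_basis D W" and x: "D *v x = 0"
  shows "W *v (transpose W *v x) = x"
proof -
  have "x \<in> span (columns W)"
    using assms by (simp add: orthonormal_null_basis_def)
  moreover have "subspace {x. W *v (transpose W *v x) = x}"
    by (rule subspaceI) (auto simp: matrix_vector_right_distrib matrix_vector_mult_scaleR)
  moreover have "columns W \<subseteq> {x. W *v (transpose W *v x) = x}"
    by (auto simp: columns_def simp flip: matrix_vector_mult_basis)
       (simp add: matrix_vector_mul_assoc matrix_mul_assoc[symmetric]
          orthonormal_null_basis_transpose_mult[OF W])
  ultimately show ?thesis
    using span_minimal by blast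
qed

lemma orthonormal_null_basis_transition:
  fixes W W' :: "real^'n^'m"
  assumes W: "orthonormal_null_basis D W" and W': "orthonormal_null_basis D W'"
  shows "W ** (transpose W ** W') = W'"
proof -
  have "D *v (W' *v y) = 0" for y
    using W' matrix_vector_mult_in_columnspace[of W' y]
    by (auto simp: orthonormal_null_basis_def)
  then have "(W ** (transpose W ** W')) *v y = W' *v y" for y
    using orthonormal_null_basis_projection[OF W] by (simp flip: matrix_vector_mul_assoc)
  then show ?thesis
    by (simp add: matrix_eq)
qed

section \<open>Independence of the dimensionless groups from the basis\<close>

theorem theorem1:
  fixes D :: "real^'m^'k" and v :: "real^'k" and w :: "real^'m"
    and F :: "real^'m \<Rightarrow> real"
    and \<rho> :: "real^'m \<Rightarrow> real" and ql qu :: "real^'m"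
    and g :: "real^'n^'m \<Rightarrow> real^'n \<Rightarrow> real"
    and \<sigma> :: "real^'n^'m \<Rightarrow> real^'n \<Rightarrow> real"
    and W W' :: "real^'n^'m"
    and u u' :: "nat \<Rightarrow> real^'n"
  assumes "CARD('k) < CARD('m)" and "CARD('n) = CARD('m) - CARD('k)"
    and "rank D = CARD('k)"
    and "v \<noteq> 0" and "D *v w = v"
    and "prob_density \<rho>" and "bounded (range \<rho>)"
    and "\<And>i. 0 < ql $ i \<and> ql $ i < qu $ i"
    and "\<And>q. q \<notin> cbox ql qu \<Longrightarrow> \<rho> q = 0"
    and "\<And>V q. orthonormal_null_basis D V \<Longrightarrow> (\<And>i. 0 < q $ i) \<Longrightarrow>
           F q * exp (- (w \<bullet> log_vec q)) = g V (transpose V *v log_vec q)"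
    and "\<And>V \<gamma>. orthonormal_null_basis D V \<Longrightarrow> g V differentiable (at \<gamma>)"
    and "\<And>V i. orthonormal_null_basis D V \<Longrightarrow> continuous_on UNIV (\<lambda>\<gamma>. grad (g V) \<gamma> $ i)"
    and "\<And>V \<gamma>. orthonormal_null_basis D V \<Longrightarrow> 0 \<le> \<sigma> V \<gamma>"
    and "\<And>V. orthonormal_null_basis D V \<Longrightarrow>
           distributed (density lborel \<rho>) lborel (\<lambda>q. transpose V *v log_vec q) (\<sigma> V)"
    and "\<And>V i. orthonormal_null_basis D V \<Longrightarrow>
           integrable lborel (\<lambda>\<gamma>. (grad (g V) \<gamma> $ i)\<^sup>2 * \<sigma> V \<gamma>)"
    and "orthonormal_null_basis D W"
    and "\<And>i j. 1 \<le> i \<Longrightarrow> i < j \<Longrightarrow> j \<le> CARD('n) \<Longrightarrow>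
           nth_largest_eigenvalue (grad_outer_matrix (g W) (\<sigma> W)) j
             < nth_largest_eigenvalue (grad_outer_matrix (g W) (\<sigma> W)) i"
    and "orthonormal_null_basis D W'"
    and "\<And>i. i \<in> {1..CARD('n)} \<Longrightarrow>
           is_eigenvector (grad_outer_matrix (g W) (\<sigma> W))
             (nth_largest_eigenvalue (grad_outer_matrix (g W) (\<sigma> W)) i) (u i)"
    and "\<And>i. i \<in> {1..CARD('n)} \<Longrightarrow>
           is_eigenvector (grad_outer_matrix (g W') (\<sigma> W'))
             (nth_largest_eigenvalue (grad_outer_matrix (g W') (\<sigma> W')) i) (u' i)"
  shows "\<forall>i\<in>{1..CARD('n)}. \<exists>c. c \<noteq> 0 \<and> W' *v u' i = c *\<^sub>R (W *v u i)"
proof -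
  note F = assms(10) and diff = assms(11) and cont = assms(12) and nonneg = assms(13)
    and distr = assms(14) and sq = assms(15) and W = assms(16) and less = assms(17)
    and W' = assms(18) and u = assms(19) and u' = assms(20)
  define Q where "Q = transpose W ** W'"
  define A where "A = grad_outer_matrix (g W) (\<sigma> W)"
  define B where "B = grad_outer_matrix (g W') (\<sigma> W')"
  have WQ: "W ** Q = W'"
    unfolding Q_def by (rule orthonormal_null_basis_transition[OF W W'])
  have Qt: "transpose Q = transpose W' ** W"
    by (simp add: Q_def matrix_transpose_mul)
  \<comment> \<open>The projection identity with \<open>W\<close> and \<open>W'\<close> exchanged, once transposed, relates
    the two coordinate maps on all vectors, also outside the null space.\<close>
  have "W' ** transpose Q = W"
    unfolding Qt by (rule orthonormal_null_basis_transition[OF W' W])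
  then have QW't: "Q ** transpose W' = transpose W"
    by (metis matrix_transpose_mul transpose_transpose)
  have QtQ: "transpose Q ** Q = mat 1"
    using orthonormal_null_basis_transpose_mult[OF W'] WQ
    by (simp add: Qt flip: matrix_mul_assoc)
  then have QQt: "Q ** transpose Q = mat 1"
    by (simp add: matrix_left_right_inverse)
  have gW': "g W' = (\<lambda>\<gamma>. g W (Q *v \<gamma>))"
  proof
    fix \<gamma>
    \<comment> \<open>A positive vector with \<open>W'\<^sup>T log q = \<gamma>\<close>, so the two representations can be
      compared at every \<open>\<gamma>\<close>, including those where the density vanishes.\<close>
    define q where "q = (\<chi> i. exp ((W' *v \<gamma>) $ i))"
    have pos: "0 < q $ i" for i
      by (simp add: q_def)
    have log_q: "log_vec q = W' *v \<gamma>"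
      by (simp add: log_vec_def q_def vec_eq_iff)
    have "g W' (transpose W' *v log_vec q) = g W (transpose W *v log_vec q)"
      using F[OF W pos] F[OF W' pos] by simp
    then show "g W' \<gamma> = g W (Q *v \<gamma>)"
      by (simp add: log_q matrix_vector_mul_assoc orthonormal_null_basis_transpose_mult[OF W'] Q_def)
  qed
  have B: "B = transpose Q ** A ** Q"
    unfolding A_def B_def gW'
  proof (rule grad_outer_matrix_change_of_variables
      [OF distr[OF W] nonneg[OF W] distr[OF W'] nonneg[OF W'] _ diff[OF W] _ sq[OF W]])
    show "transpose W *v log_vec q = Q *v (transpose W' *v log_vec q)" for q
      by (simp add: matrix_vector_mul_assoc QW't)
    show "(\<lambda>\<gamma>. grad (g W) \<gamma> $ i) \<in> borel_measurable borel" for i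
      using cont[OF W] by (rule borel_measurable_continuous_onI)
  qed
  then have AQ: "A ** Q = Q ** B"
    by (simp add: matrix_mul_assoc QQt)
  have eigenvalues: "nth_largest_eigenvalue B i = nth_largest_eigenvalue A i" for i
    by (simp add: nth_largest_eigenvalue_def eigenvalues_desc_def charpoly_similar[OF QtQ AQ])
  have inj: "inj_on (nth_largest_eigenvalue A) {1..CARD('n)}"
    by (rule linorder_inj_onI) (use less in \<open>fastforce simp: A_def\<close>)+
  show ?thesis
  proof
    fix i
    assume i: "i \<in> {1..CARD('n)}"
    have "u' i \<noteq> 0" and "B *v u' i = nth_largest_eigenvalue A i *\<^sub>R u' i"
      using u'[OF i] eigenvalues by (auto simp: is_eigenvector_def B_def)
    moreover have "Q *v u' i \<noteq> 0"
      using \<open>u' i \<noteq> 0\<close> QtQ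
      by (metis matrix_vector_mul_assoc matrix_vector_mul_lid matrix_vector_mult_0_right)
    moreover have "A *v (Q *v u' i) = Q *v (B *v u' i)"
      by (simp add: matrix_vector_mul_assoc AQ)
    ultimately have "is_eigenvector A (nth_largest_eigenvalue A i) (Q *v u' i)"
      by (simp add: is_eigenvector_def matrix_vector_mult_scaleR)
    then obtain c where "c \<noteq> 0" "Q *v u' i = c *\<^sub>R u i"
      using simple_spectrum_eigenvector_unique[OF _ _ inj _ i, of A u] u
      by (auto simp: A_def transpose_grad_outer_matrix)
    moreover have "W' *v u' i = W *v (Q *v u' i)"
      by (simp add: matrix_vector_mul_assoc WQ)
    ultimately show "\<exists>c. c \<noteq> 0 \<and> W' *v u' i = c *\<^sub>R (W *v u i)"
      by (auto simp: matrix_vector_mult_scaleR)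
  qed
qed

end
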